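(* Let $F:S^N\to\mathbb{R}$ be uniformly elliptic, let $h$ be a Lipschitz continuous vector field, let $f$ be a continuous function, and let $b$ satisfy [b1] and [b2] (recalled in the context). Suppose that, for $\alpha\in(-1,0)$, $u$ is a viscosity solution of $$|\nabla u|^\alpha\big(F(D^2u)+h(x)\cdot\nabla u\big)+b(x,\nabla u)=f(x)$$ in an open set $\Omega\subset\mathbb{R}^N$. Then $u$ is a viscosity solution in $\Omega$ of $$F(D^2u)+h(x)\cdot\nabla u+|\nabla u|^{-\alpha}b(x,\nabla u)=f(x)|\nabla u|^{-\alpha}.$$
   Context: $S^N$ is the space of symmetric $N\times N$ matrices. $F$ uniformly elliptic means: for some $0<\lambda\le\Lambda$, $\lambda\,\mathrm{tr}N\le F(M+N)-F(M)\le\Lambda\,\mathrm{tr}N$ for all $M\in S^N$ and all $N\in S^N$ with $N\ge0$. Conditions on $b:\mathbb{R}^N\times\mathbb{R}^N\to\mathbb{R}$: [b1] there exist $\beta_o,\beta_\infty\in(0,1+\alpha)$, $\gamma\ge\sup(\beta_o,\beta_\infty)$ and $M_o>0$ such that $\|b(\cdot,q)\|_{\mathcal{C}^{0,\gamma}}\le M_o(|q|^{\beta_o}+|q|^{\beta_\infty})$ for all $q$ (Hölder norm); [b2] there exist $Q$ and $C_b$ such that for all $p\ne0$ and $|q|\le Q|p|$, $|b(x,p+q)-b(x,p)|\le C_b\sup(|p|^{\beta_\infty-1},|p|^{\beta_o-1})|q|$. Viscosity solutions of the first (singular) equation are understood in the sense of Birindelli and Demengel: a continuous $u$ is a supersolution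 (resp. subsolution) if for every $x_0\in\Omega$, either $u$ is constant in a ball around $x_0$ and $0\le f$ (resp. $0\ge f$) in that ball, or for every $\mathcal{C}^2$ function $\varphi$ such that $u-\varphi$ has a local minimum (resp. maximum) at $x_0$ and $\nabla\varphi(x_0)\ne0$, the left-hand side evaluated at $x_0$ with $(\nabla\varphi,D^2\varphi)(x_0)$ is $\le f(x_0)$ (resp. $\ge f(x_0)$). For the second equation the notion is the usual one (all $\mathcal{C}^2$ test functions, no restriction on $\nabla\varphi(x_0)$; supersolution means left-hand side $\le$ right-hand side, subsolution means $\ge$). A solution is both a sub- and a supersolution.
   Formalization: The normalisation F(0)=0 is added; without it the claim fails, e.g. F(M)=tr M+1, h=b=f=0, u=0 solves the first equation by the locally constant alternative but not the second. In [b2], Q is taken positive. *)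

theory Defs
  imports "HOL-Analysis.Analysis"
begin

definition symmetric_mat :: "real^'n^'n \<Rightarrow> bool" where
  "symmetric_mat A \<longleftrightarrow> transpose A = A"

definition psd_mat :: "real^'n^'n \<Rightarrow> bool" where
  "psd_mat A \<longleftrightarrow> symmetric_mat A \<and> (\<forall>x. 0 \<le> x \<bullet> (A *v x))"

text \<open>An operator on the symmetric matrices is a total function on all square matrices;
  nothing is required of its values off the symmetric ones.\<close>

definition uniformly_elliptic :: "(real^'n^'n \<Rightarrow> real) \<Rightarrow> bool" where
  "uniformly_elliptic F \<longleftrightarrow>
    (\<exists>lam Lam. 0 < lam \<and> lam \<le> Lam \<and>
      (\<forall>M N. symmetric_mat M \<and> psd_mat N \<longrightarrow>
        lam * trace N \<le> F (M + N) - F M \<and> F (M + N) - F M \<le> Lam * trace N))"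

text \<open>The full \<open>\<C>\<^sup>0\<^sup>,\<^sup>\<gamma>\<close> norm, supremum plus seminorm, with value \<open>\<infinity>\<close> for functions
  outside the space.\<close>

definition hoelder_norm :: "real \<Rightarrow> (real^'n \<Rightarrow> real) \<Rightarrow> ennreal" where
  "hoelder_norm \<gamma> g =
    (SUP x. ennreal \<bar>g x\<bar>) +
    (SUP (x, y) \<in> {(x, y). x \<noteq> y}. ennreal (\<bar>g x - g y\<bar> / norm (x - y) powr \<gamma>))"

definition cond_b1 ::
    "real \<Rightarrow> real \<Rightarrow> real \<Rightarrow> (real^'n \<Rightarrow> real^'n \<Rightarrow> real) \<Rightarrow> bool" where
  "cond_b1 \<alpha> \<beta>o \<beta>inf b \<longleftrightarrow>
    \<beta>o \<in> {0<..<1 + \<alpha>} \<and> \<beta>inf \<in> {0<..<1 + \<alpha>} \<and>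
    (\<exists>\<gamma> Mo. \<gamma> \<ge> max \<beta>o \<beta>inf \<and> Mo > 0 \<and>
      (\<forall>q. hoelder_norm \<gamma> (\<lambda>x. b x q) \<le> ennreal (Mo * (norm q powr \<beta>o + norm q powr \<beta>inf))))"

text \<open>Positivity of \<open>Q\<close> is needed for the condition to have any content.\<close>

definition cond_b2 :: "real \<Rightarrow> real \<Rightarrow> (real^'n \<Rightarrow> real^'n \<Rightarrow> real) \<Rightarrow> bool" where
  "cond_b2 \<beta>o \<beta>inf b \<longleftrightarrow>
    (\<exists>Q Cb. Q > 0 \<and>
      (\<forall>x p q. p \<noteq> 0 \<and> norm q \<le> Q * norm p \<longrightarrow>
        \<bar>b x (p + q) - b x p\<bar>
          \<le> Cb * max (norm p powr (\<beta>inf - 1)) (norm p powr (\<beta>o - 1)) * norm q))"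

text \<open>\<open>\<phi>\<close> is of class \<open>\<C>\<^sup>2\<close> on the open set \<open>\<Omega>\<close>, with gradient \<open>D\<close> and Hessian \<open>D2\<close> there.\<close>

definition C2_on ::
    "(real^'n) set \<Rightarrow> (real^'n \<Rightarrow> real) \<Rightarrow> (real^'n \<Rightarrow> real^'n) \<Rightarrow> (real^'n \<Rightarrow> real^'n^'n) \<Rightarrow> bool" where
  "C2_on \<Omega> \<phi> D D2 \<longleftrightarrow>
    (\<forall>x\<in>\<Omega>. (\<phi> has_derivative (\<lambda>v. D x \<bullet> v)) (at x)) \<and>
    (\<forall>x\<in>\<Omega>. (D has_derivative (\<lambda>v. D2 x *v v)) (at x)) \<and>
    continuous_on \<Omega> D2"

definition local_min_at :: "(real^'n) set \<Rightarrow> (real^'n \<Rightarrow> real) \<Rightarrow> real^'n \<Rightarrow> bool" where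
  "local_min_at \<Omega> w x0 \<longleftrightarrow> (\<forall>\<^sub>F x in at x0 within \<Omega>. w x0 \<le> w x)"

definition local_max_at :: "(real^'n) set \<Rightarrow> (real^'n \<Rightarrow> real) \<Rightarrow> real^'n \<Rightarrow> bool" where
  "local_max_at \<Omega> w x0 \<longleftrightarrow> (\<forall>\<^sub>F x in at x0 within \<Omega>. w x \<le> w x0)"

text \<open>Viscosity notions in the sense of Birindelli and Demengel for an equation
  \<open>G x (\<nabla>u) (D\<^sup>2u) = f x\<close> that is singular where the gradient vanishes. The alternative for
  locally constant \<open>u\<close> takes the left-hand side to be \<open>0\<close> on constants.\<close>

definition bd_supersolution ::
    "(real^'n) set \<Rightarrow> (real^'n \<Rightarrow> real^'n \<Rightarrow> real^'n^'n \<Rightarrow> real) \<Rightarrow> (real^'n \<Rightarrow> real)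
      \<Rightarrow> (real^'n \<Rightarrow> real) \<Rightarrow> bool" where
  "bd_supersolution \<Omega> G f u \<longleftrightarrow> continuous_on \<Omega> u \<and>
    (\<forall>x0\<in>\<Omega>.
      (\<exists>r>0. ball x0 r \<subseteq> \<Omega> \<and> u constant_on ball x0 r \<and> (\<forall>x\<in>ball x0 r. 0 \<le> f x)) \<or>
      (\<forall>\<phi> D D2. C2_on \<Omega> \<phi> D D2 \<and> local_min_at \<Omega> (\<lambda>x. u x - \<phi> x) x0 \<and> D x0 \<noteq> 0
        \<longrightarrow> G x0 (D x0) (D2 x0) \<le> f x0))"

definition bd_subsolution ::
    "(real^'n) set \<Rightarrow> (real^'n \<Rightarrow> real^'n \<Rightarrow> real^'n^'n \<Rightarrow> real) \<Rightarrow> (real^'n \<Rightarrow> real)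
      \<Rightarrow> (real^'n \<Rightarrow> real) \<Rightarrow> bool" where
  "bd_subsolution \<Omega> G f u \<longleftrightarrow> continuous_on \<Omega> u \<and>
    (\<forall>x0\<in>\<Omega>.
      (\<exists>r>0. ball x0 r \<subseteq> \<Omega> \<and> u constant_on ball x0 r \<and> (\<forall>x\<in>ball x0 r. 0 \<ge> f x)) \<or>
      (\<forall>\<phi> D D2. C2_on \<Omega> \<phi> D D2 \<and> local_max_at \<Omega> (\<lambda>x. u x - \<phi> x) x0 \<and> D x0 \<noteq> 0
        \<longrightarrow> G x0 (D x0) (D2 x0) \<ge> f x0))"

definition bd_solution ::
    "(real^'n) set \<Rightarrow> (real^'n \<Rightarrow> real^'n \<Rightarrow> real^'n^'n \<Rightarrow> real) \<Rightarrow> (real^'n \<Rightarrow> real)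
      \<Rightarrow> (real^'n \<Rightarrow> real) \<Rightarrow> bool" where
  "bd_solution \<Omega> G f u \<longleftrightarrow> bd_supersolution \<Omega> G f u \<and> bd_subsolution \<Omega> G f u"

text \<open>The usual viscosity notions for \<open>G x (\<nabla>u) (D\<^sup>2u) = R x (\<nabla>u)\<close>; the right-hand side may
  depend on the gradient.\<close>

definition visc_supersolution ::
    "(real^'n) set \<Rightarrow> (real^'n \<Rightarrow> real^'n \<Rightarrow> real^'n^'n \<Rightarrow> real) \<Rightarrow> (real^'n \<Rightarrow> real^'n \<Rightarrow> real)
      \<Rightarrow> (real^'n \<Rightarrow> real) \<Rightarrow> bool" where
  "visc_supersolution \<Omega> G R u \<longleftrightarrow> continuous_on \<Omega> u \<and>
    (\<forall>x0\<in>\<Omega>. \<forall>\<phi> D D2. C2_on \<Omega> \<phi> D D2 \<and> local_min_at \<Omega> (\<lambda>x. u x - \<phi> x) x0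
      \<longrightarrow> G x0 (D x0) (D2 x0) \<le> R x0 (D x0))"

definition visc_subsolution ::
    "(real^'n) set \<Rightarrow> (real^'n \<Rightarrow> real^'n \<Rightarrow> real^'n^'n \<Rightarrow> real) \<Rightarrow> (real^'n \<Rightarrow> real^'n \<Rightarrow> real)
      \<Rightarrow> (real^'n \<Rightarrow> real) \<Rightarrow> bool" where
  "visc_subsolution \<Omega> G R u \<longleftrightarrow> continuous_on \<Omega> u \<and>
    (\<forall>x0\<in>\<Omega>. \<forall>\<phi> D D2. C2_on \<Omega> \<phi> D D2 \<and> local_max_at \<Omega> (\<lambda>x. u x - \<phi> x) x0
      \<longrightarrow> G x0 (D x0) (D2 x0) \<ge> R x0 (D x0))"

definition visc_solution ::
    "(real^'n) set \<Rightarrow> (real^'n \<Rightarrow> real^'n \<Rightarrow> real^'n^'n \<Rightarrow> real) \<Rightarrow> (real^'n \<Rightarrow> real^'n \<Rightarrow> real)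
      \<Rightarrow> (real^'n \<Rightarrow> real) \<Rightarrow> bool" where
  "visc_solution \<Omega> G R u \<longleftrightarrow> visc_supersolution \<Omega> G R u \<and> visc_subsolution \<Omega> G R u"

text \<open>Since \<open>0 powr a = 0\<close>, for \<open>\<alpha> < 0\<close> the factor \<open>norm p powr (-\<alpha>)\<close> has its correct value
  at \<open>p = 0\<close>, while \<open>norm p powr \<alpha>\<close> has a junk value there; the singular equation is only
  ever tested with \<open>p \<noteq> 0\<close>.\<close>

definition singular_lhs ::
    "real \<Rightarrow> (real^'n^'n \<Rightarrow> real) \<Rightarrow> (real^'n \<Rightarrow> real^'n) \<Rightarrow> (real^'n \<Rightarrow> real^'n \<Rightarrow> real)
      \<Rightarrow> real^'n \<Rightarrow> real^'n \<Rightarrow> real^'n^'n \<Rightarrow> real" where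
  "singular_lhs \<alpha> F h b x p X = norm p powr \<alpha> * (F X + h x \<bullet> p) + b x p"

definition regular_lhs ::
    "real \<Rightarrow> (real^'n^'n \<Rightarrow> real) \<Rightarrow> (real^'n \<Rightarrow> real^'n) \<Rightarrow> (real^'n \<Rightarrow> real^'n \<Rightarrow> real)
      \<Rightarrow> real^'n \<Rightarrow> real^'n \<Rightarrow> real^'n^'n \<Rightarrow> real" where
  "regular_lhs \<alpha> F h b x p X = F X + h x \<bullet> p + norm p powr (-\<alpha>) * b x p"

end

theory Submission
  imports Defs
begin

text \<open>Only test functions whose gradient vanishes at the touching point \<open>x0\<close> need an argument. If
  such a \<open>\<phi>\<close> touches \<open>u\<close> from below and \<open>F (D\<^sup>2\<phi> x0) > 0\<close>, then by ellipticity also \<open>F A > 0\<close> for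
  \<open>A = D\<^sup>2\<phi> x0 - e I\<close> with \<open>e > 0\<close> small and \<open>A\<close> nonsingular, and the quadratic form of \<open>A\<close> touches
  \<open>u\<close> strictly. For \<open>y\<close> near \<open>x0\<close>, minimise \<open>u x - (x - y) \<bullet> A (x - y) / 2\<close> over a small ball. At a
  minimum point with \<open>x \<noteq> y\<close> the test gradient \<open>A (x - y)\<close> is nonzero and small, so the singular
  equation, multiplied by the power \<open>-\<alpha>\<close> of the gradient, bounds \<open>F A\<close> by
  an arbitrarily small number, a contradiction. Hence the minimum is
  attained at \<open>y\<close> itself for every \<open>y\<close>; the resulting bound \<open>u y - u x \<le> C |x - y|\<^sup>2\<close> makes \<open>u\<close>
  locally constant, and then the touching forces \<open>A \<le> 0\<close> and \<open>F A \<le> 0\<close>. The subsolution case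
  follows by passing to \<open>-u\<close> and \<open>M \<mapsto> -F (-M)\<close>.\<close>

section \<open>Symmetric and positive semidefinite matrices\<close>

lemma matrix_vector_mult_minus_left: "(- A) *v x = - (A *v x)" for A :: "real^'n^'m"
  by (simp add: matrix_vector_mult_def vec_eq_iff sum_negf)

lemma transpose_inner: "x \<bullet> (A *v y) = (transpose A *v x) \<bullet> y" for A :: "real^'n^'m"
  by (simp add: dot_lmul_matrix)

lemma symmetric_mat_inner: "symmetric_mat A \<Longrightarrow> x \<bullet> (A *v y) = (A *v x) \<bullet> y"
  unfolding symmetric_mat_def using transpose_inner[of x A y] by simp

lemma symmetric_mat_iff_inner:
  "symmetric_mat A \<longleftrightarrow> (\<forall>x y. x \<bullet> (A *v y) = y \<bullet> (A *v x))"
proof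
  assume "symmetric_mat A"
  then show "\<forall>x y. x \<bullet> (A *v y) = y \<bullet> (A *v x)"
    using symmetric_mat_inner[of A] inner_commute by metis
next
  assume *: "\<forall>x y. x \<bullet> (A *v y) = y \<bullet> (A *v x)"
  have "transpose A *v y = A *v y" for y
  proof -
    have "(transpose A *v y) \<bullet> x = (A *v y) \<bullet> x" for x
      using transpose_inner[of y A x] *[rule_format, of y x] inner_commute[of x "A *v y"] by simp
    then show ?thesis
      using vector_eq_rdot by blast
  qed
  then show "symmetric_mat A"
    unfolding symmetric_mat_def by (simp add: matrix_eq)
qed

lemma mat_scaleR_vector_mult: "(c *\<^sub>R mat 1) *v x = c *\<^sub>R x" for x :: "real^'n"
  by (simp add: scaleR_matrix_vector_assoc [symmetric])

lemma symmetric_mat_mat: "symmetric_mat (c *\<^sub>R mat 1 :: real^'n^'n)"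
  unfolding symmetric_mat_iff_inner
  by (simp add: mat_scaleR_vector_mult inner_commute)

lemma symmetric_mat_diff: "symmetric_mat A \<Longrightarrow> symmetric_mat B \<Longrightarrow> symmetric_mat (A - B)"
  by (simp add: symmetric_mat_def transpose_def vec_eq_iff)

lemma symmetric_mat_uminus: "symmetric_mat A \<Longrightarrow> symmetric_mat (- A)"
  by (simp add: symmetric_mat_def transpose_def vec_eq_iff)

lemma psd_mat_mat: "c \<ge> 0 \<Longrightarrow> psd_mat (c *\<^sub>R mat 1 :: real^'n^'n)"
  by (simp add: psd_mat_def symmetric_mat_mat mat_scaleR_vector_mult)

lemma trace_psd_nonneg:
  assumes "psd_mat (A :: real^'n^'n)"
  shows "0 \<le> trace A"
proof -
  have "0 \<le> A $ i $ i" for i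
  proof -
    have "0 \<le> axis i 1 \<bullet> (A *v axis i 1)"
      using assms by (simp add: psd_mat_def)
    also have "\<dots> = A $ i $ i"
      by (simp add: inner_axis' matrix_vector_mul_component inner_axis)
    finally show ?thesis .
  qed
  then show ?thesis
    by (simp add: trace_def sum_nonneg)
qed

text \<open>The shifts in question are the eigenvalues of \<open>A\<close>. Eigenvectors of a
  symmetric matrix for distinct eigenvalues are orthogonal, hence independent, so only finitely many
  exist. An arbitrarily small shift can therefore be chosen that leaves a nonsingular
  matrix.\<close>

lemma finite_singular_shifts:
  fixes A :: "real^'n^'n"
  assumes "symmetric_mat A"
  shows "finite {e. \<exists>v. v \<noteq> 0 \<and> (A - e *\<^sub>R mat 1) *v v = 0}" (is "finite ?S")
proof -
  define S where "S = ?S"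
  have "\<exists>v. v \<noteq> 0 \<and> A *v v = e *\<^sub>R v" if "e \<in> S" for e
    using that by (auto simp: S_def matrix_vector_mult_diff_rdistrib mat_scaleR_vector_mult)
  then obtain v where v: "\<And>e. e \<in> S \<Longrightarrow> v e \<noteq> 0 \<and> A *v v e = e *\<^sub>R v e"
    by metis
  have orth: "v e \<bullet> v e' = 0" if "e \<in> S" "e' \<in> S" "e \<noteq> e'" for e e'
    using symmetric_mat_inner[OF assms, of "v e" "v e'"] v[OF that(1)] v[OF that(2)] that(3)
    by simp
  have "inj_on v S"
  proof (rule inj_onI, rule ccontr)
    fix e e' assume "e \<in> S" "e' \<in> S" "v e = v e'" "e \<noteq> e'"
    then show False
      using orth[of e e'] v[of e] by simp
  qed
  moreover have "pairwise orthogonal (v ` S)"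
    unfolding pairwise_image unfolding pairwise_def orthogonal_def using orth by blast
  then have "independent (v ` S)"
    using v by (intro pairwise_orthogonal_independent) auto
  then have "finite (v ` S)"
    using independent_bound by blast
  ultimately have "finite S"
    using finite_imageD by blast
  then show ?thesis
    unfolding S_def .
qed

section \<open>Second-order calculus of test functions\<close>

lemma small_scale:
  fixes d n :: real
  assumes "d > 0" "n \<ge> 0"
  obtains t where "t > 0" "t * n < d"
proof
  show "d / (n + 1) > 0" "d / (n + 1) * n < d"
    using assms by (simp_all add: pos_divide_less_eq)
qed

lemma gradient_along_line:
  fixes x0 w :: "real^'n"
  assumes "(\<phi> has_derivative (\<lambda>v. D (x0 + s *\<^sub>R w) \<bullet> v)) (at (x0 + s *\<^sub>R w))"
  shows "((\<lambda>s. \<phi> (x0 + s *\<^sub>R w)) has_real_derivative D (x0 + s *\<^sub>R w) \<bullet> w) (at s)"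
proof -
  have "((\<lambda>s. x0 + s *\<^sub>R w) has_derivative (\<lambda>t. t *\<^sub>R w)) (at s)"
    by (auto intro!: derivative_eq_intros)
  from diff_chain_at[OF this assms] show ?thesis
    by (simp add: has_field_derivative_def o_def mult_commute_abs)
qed

lemma C2_on_gradient_remainder:
  fixes x0 :: "real^'n"
  assumes "open \<Omega>" "C2_on \<Omega> \<phi> D D2" "x0 \<in> \<Omega>" "e > 0"
  obtains d where "d > 0" "ball x0 d \<subseteq> \<Omega>"
    "\<And>w. norm w < d \<Longrightarrow> norm (D (x0 + w) - D x0 - D2 x0 *v w) \<le> e * norm w"
proof -
  obtain d1 where d1: "d1 > 0" "ball x0 d1 \<subseteq> \<Omega>"
    using assms(1,3) openE by blast
  have "(D has_derivative (\<lambda>v. D2 x0 *v v)) (at x0)"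
    using assms by (simp add: C2_on_def)
  then obtain d2 where d2: "d2 > 0"
    "\<And>y. norm (y - x0) < d2 \<Longrightarrow> norm (D y - D x0 - D2 x0 *v (y - x0)) \<le> e * norm (y - x0)"
    using assms(4) unfolding has_derivative_at_alt by blast
  show ?thesis
  proof
    show "min d1 d2 > 0" "ball x0 (min d1 d2) \<subseteq> \<Omega>"
      using d1 d2 by auto
    show "norm (D (x0 + w) - D x0 - D2 x0 *v w) \<le> e * norm w" if "norm w < min d1 d2" for w
      using d2(2)[of "x0 + w"] that by simp
  qed
qed

text \<open>The mean value theorem in the direction \<open>v\<close> turns the second difference
  into a difference of two gradients, and the linearisation \<open>R\<close> of the gradient at
  \<open>x0\<close> evaluates that difference. The second difference is symmetric in
  \<open>v\<close> and \<open>w\<close>, which yields the symmetry of the Hessian.\<close>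

lemma second_difference_estimate:
  fixes x0 v w :: "real^'n"
  assumes \<phi>: "\<And>x. x \<in> ball x0 d \<Longrightarrow> (\<phi> has_derivative (\<lambda>v. D x \<bullet> v)) (at x)"
    and R: "\<And>w. norm w < d \<Longrightarrow> norm (D (x0 + w) - D x0 - A *v w) \<le> e * norm w"
    and t: "t > 0" "t * (norm v + norm w) < d" and "e \<ge> 0"
  shows "\<bar>\<phi> (x0 + t *\<^sub>R v + t *\<^sub>R w) - \<phi> (x0 + t *\<^sub>R v) - \<phi> (x0 + t *\<^sub>R w) + \<phi> x0
            - t\<^sup>2 * (v \<bullet> (A *v w))\<bar> \<le> 2 * e * t\<^sup>2 * (norm v + norm w) * norm v"
proof -
  define g where "g s = \<phi> ((x0 + t *\<^sub>R w) + s *\<^sub>R v) - \<phi> (x0 + s *\<^sub>R v)" for s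
  define g' where "g' s = D ((x0 + t *\<^sub>R w) + s *\<^sub>R v) \<bullet> v - D (x0 + s *\<^sub>R v) \<bullet> v" for s
  have small: "norm (s *\<^sub>R v) \<le> t * (norm v + norm w)"
      "norm (t *\<^sub>R w + s *\<^sub>R v) \<le> t * (norm v + norm w)"
    if "0 \<le> s" "s \<le> t" for s
  proof -
    have "s * norm v \<le> t * norm v" "0 \<le> t * norm w"
      using that t by (auto intro: mult_right_mono)
    moreover have "norm (t *\<^sub>R w + s *\<^sub>R v) \<le> t * norm w + s * norm v"
      using norm_triangle_ineq[of "t *\<^sub>R w" "s *\<^sub>R v"] that t by simp
    ultimately show "norm (s *\<^sub>R v) \<le> t * (norm v + norm w)"
        "norm (t *\<^sub>R w + s *\<^sub>R v) \<le> t * (norm v + norm w)"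
      unfolding distrib_left using that by (simp_all only: norm_scaleR abs_of_nonneg)
  qed
  have "(g has_real_derivative g' s) (at s)" if "0 \<le> s" "s \<le> t" for s
    unfolding g_def g'_def
    using small[OF that] t
    by (intro DERIV_diff gradient_along_line \<phi>)
      (auto simp: dist_norm algebra_simps norm_minus_commute)
  then obtain s where s: "0 < s" "s < t" "g t - g 0 = (t - 0) * g' s"
    using MVT2[of 0 t g g'] t by auto
  define R1 where "R1 = D (x0 + (t *\<^sub>R w + s *\<^sub>R v)) - D x0 - A *v (t *\<^sub>R w + s *\<^sub>R v)"
  define R2 where "R2 = D (x0 + s *\<^sub>R v) - D x0 - A *v (s *\<^sub>R v)"
  define \<mu> where "\<mu> = e * (t * (norm v + norm w))"
  have "norm R1 \<le> e * norm (t *\<^sub>R w + s *\<^sub>R v)" "norm R2 \<le> e * norm (s *\<^sub>R v)"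
    unfolding R1_def R2_def using small[of s] s t
    by (intro R; linarith)+
  then have R12: "norm R1 \<le> \<mu>" "norm R2 \<le> \<mu>"
    unfolding \<mu>_def using small[of s] s \<open>e \<ge> 0\<close> 
    by (meson mult_left_mono order_trans less_imp_le)+
  \<comment> \<open>Subtracting the two linearisations cancels \<open>D x0\<close> and the term
    \<open>A *v (s *\<^sub>R v)\<close>; only the increment along \<open>w\<close> survives.\<close>
  have "g' s = t * (v \<bullet> (A *v w)) + (R1 - R2) \<bullet> v"
    unfolding g'_def R1_def R2_def
    by (simp add: inner_diff_left inner_add_left matrix_vector_right_distrib
        matrix_vector_mult_scaleR algebra_simps inner_commute)
  then have "g t - g 0 - t\<^sup>2 * (v \<bullet> (A *v w)) = t * ((R1 - R2) \<bullet> v)"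
    using s(3) by (simp add: power2_eq_square distrib_left mult.assoc)
  moreover have "\<bar>(R1 - R2) \<bullet> v\<bar> \<le> 2 * \<mu> * norm v"
  proof -
    have "norm (R1 - R2) \<le> 2 * \<mu>"
      using norm_triangle_ineq4[of R1 R2] R12 by linarith
    then have "norm (R1 - R2) * norm v \<le> 2 * \<mu> * norm v"
      by (rule mult_right_mono) simp
    then show ?thesis
      using Cauchy_Schwarz_ineq2[of "R1 - R2" v] by linarith
  qed
  ultimately have "\<bar>g t - g 0 - t\<^sup>2 * (v \<bullet> (A *v w))\<bar> \<le> t * (2 * \<mu> * norm v)"
    using t by (simp add: abs_mult)
  then show ?thesis
    unfolding g_def \<mu>_def by (simp add: algebra_simps power2_eq_square)
qed

text \<open>\<open>C2_on\<close> admits any matrix field as \<open>D2\<close>, while ellipticity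
  speaks only of symmetric matrices. Computing the same second difference in both orders shows that
  the two bilinear values differ by at most a multiple of \<open>e\<close>, for every
  \<open>e > 0\<close>.\<close>

lemma C2_on_hessian_symmetric:
  fixes x0 :: "real^'n"
  assumes "open \<Omega>" "C2_on \<Omega> \<phi> D D2" "x0 \<in> \<Omega>"
  shows "symmetric_mat (D2 x0)"
  unfolding symmetric_mat_iff_inner
proof (intro allI)
  fix v w :: "real^'n"
  let ?A = "D2 x0" and ?n = "norm v + norm w"
  have "\<bar>v \<bullet> (?A *v w) - w \<bullet> (?A *v v)\<bar> \<le> e * (2 * ?n\<^sup>2)" if e: "e > 0" for e
  proof -
    obtain d where d: "d > 0" "ball x0 d \<subseteq> \<Omega>"
        "\<And>w. norm w < d \<Longrightarrow> norm (D (x0 + w) - D x0 - ?A *v w) \<le> e * norm w"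
      using C2_on_gradient_remainder[OF assms e] by blast
    have \<phi>: "\<And>x. x \<in> ball x0 d \<Longrightarrow> (\<phi> has_derivative (\<lambda>v. D x \<bullet> v)) (at x)"
      using assms(2) d(2) by (auto simp: C2_on_def)
    obtain t where t: "t > 0" "t * ?n < d"
      using small_scale[OF d(1), of ?n] by auto
    note est = second_difference_estimate[OF \<phi> d(3) t(1)]
    let ?\<Delta> = "\<phi> (x0 + t *\<^sub>R v + t *\<^sub>R w) - \<phi> (x0 + t *\<^sub>R v) - \<phi> (x0 + t *\<^sub>R w) + \<phi> x0"
    have 1: "\<bar>?\<Delta> - t\<^sup>2 * (v \<bullet> (?A *v w))\<bar> \<le> 2 * e * t\<^sup>2 * ?n * norm v"
      using est[where v=v and w=w] t(2) e by simp
    have 2: "\<bar>?\<Delta> - t\<^sup>2 * (w \<bullet> (?A *v v))\<bar> \<le> 2 * e * t\<^sup>2 * ?n * norm w"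
      using est[where v=w and w=v] t(2) e by (simp add: add_ac algebra_simps)
    have "\<bar>t\<^sup>2 * (v \<bullet> (?A *v w)) - t\<^sup>2 * (w \<bullet> (?A *v v))\<bar> \<le> 2 * e * t\<^sup>2 * ?n * norm v + 2 * e * t\<^sup>2 * ?n * norm w"
      using 1 2 by linarith
    also have "\<dots> = t\<^sup>2 * (e * (2 * ?n\<^sup>2))"
      by (simp add: algebra_simps power2_eq_square)
    finally have "t\<^sup>2 * \<bar>v \<bullet> (?A *v w) - w \<bullet> (?A *v v)\<bar> \<le> t\<^sup>2 * (e * (2 * ?n\<^sup>2))"
      by (simp add: abs_mult flip: right_diff_distrib)
    then show ?thesis
      using t(1) by simp
  qed
  note * = this
  have "\<bar>v \<bullet> (?A *v w) - w \<bullet> (?A *v v)\<bar> \<le> 0"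
  proof (rule field_le_epsilon)
    fix e :: real assume "e > 0"
    have "?n\<^sup>2 \<ge> 0" by simp
    \<comment> \<open>The summand 1 keeps the denominator positive when \<open>v\<close> and
      \<open>w\<close> both vanish.\<close>
    then have "e / (2 * ?n\<^sup>2 + 1) * (2 * ?n\<^sup>2) \<le> e" "e / (2 * ?n\<^sup>2 + 1) > 0"
      using \<open>e > 0\<close> by (auto simp: divide_simps add_nonneg_pos)
    then show "\<bar>v \<bullet> (?A *v w) - w \<bullet> (?A *v v)\<bar> \<le> 0 + e"
      using *[of "e / (2 * ?n\<^sup>2 + 1)"] by linarith
  qed
  then show "v \<bullet> (?A *v w) = w \<bullet> (?A *v v)"
    by simp
qed

text \<open>The mean value theorem is applied on the segment to \<open>\<phi>\<close> minus its
  quadratic part; the derivative of this difference is controlled by the gradient remainder.\<close>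

lemma C2_on_taylor_lower:
  fixes x0 :: "real^'n"
  assumes "open \<Omega>" "C2_on \<Omega> \<phi> D D2" "x0 \<in> \<Omega>" "D x0 = 0" "e > 0"
  obtains d where "d > 0" "ball x0 d \<subseteq> \<Omega>"
    "\<And>w. norm w < d \<Longrightarrow> \<phi> x0 + w \<bullet> (D2 x0 *v w) / 2 - e * (norm w)\<^sup>2 \<le> \<phi> (x0 + w)"
proof -
  obtain d where d: "d > 0" "ball x0 d \<subseteq> \<Omega>"
      "\<And>w. norm w < d \<Longrightarrow> norm (D (x0 + w) - D x0 - D2 x0 *v w) \<le> e * norm w"
    using C2_on_gradient_remainder[OF assms(1-3,5)] by blast
  show ?thesis
  proof
    fix w :: "real^'n" assume w: "norm w < d"
    define q where "q t = \<phi> (x0 + t *\<^sub>R w) - t\<^sup>2 * (w \<bullet> (D2 x0 *v w)) / 2" for t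
    define q' where "q' t = D (x0 + t *\<^sub>R w) \<bullet> w - t * (w \<bullet> (D2 x0 *v w))" for t
    have in_ball: "norm (t *\<^sub>R w) < d" if "0 \<le> t" "t \<le> 1" for t
      using w that mult_right_mono[of t 1 "norm w"] by simp
    have "(q has_real_derivative q' t) (at t)" if "0 \<le> t" "t \<le> 1" for t
    proof -
      have "x0 + t *\<^sub>R w \<in> \<Omega>"
        using in_ball[OF that] d(2) by (auto simp: dist_norm subset_iff)
      then have "((\<lambda>s. \<phi> (x0 + s *\<^sub>R w)) has_real_derivative D (x0 + t *\<^sub>R w) \<bullet> w) (at t)"
        using assms(2) by (intro gradient_along_line) (auto simp: C2_on_def)
      then show ?thesis
        unfolding q_def q'_def by (auto intro!: derivative_eq_intros)
    qed
    then obtain t where t: "0 < t" "t < 1" "q 1 - q 0 = (1 - 0) * q' t"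
      using MVT2[of 0 1 q q'] by auto
    define R where "R = D (x0 + t *\<^sub>R w) - D x0 - D2 x0 *v (t *\<^sub>R w)"
    have "norm R \<le> e * norm (t *\<^sub>R w)"
      unfolding R_def using t by (intro d(3) in_ball) auto
    also have "\<dots> \<le> e * norm w"
      using t assms(5) by (simp add: mult_left_le_one_le)
    finally have "norm R * norm w \<le> e * norm w * norm w"
      by (rule mult_right_mono) simp
    moreover have "q' t = R \<bullet> w"
      unfolding q'_def R_def using assms(4)
      by (simp add: inner_diff_left matrix_vector_mult_scaleR inner_commute[of w])
    ultimately have "- (e * (norm w)\<^sup>2) \<le> q' t"
      using Cauchy_Schwarz_ineq2[of R w] by (simp add: power2_eq_square mult.assoc)
    then show "\<phi> x0 + w \<bullet> (D2 x0 *v w) / 2 - e * (norm w)\<^sup>2 \<le> \<phi> (x0 + w)"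
      using t by (simp add: q_def)
  qed (use d in auto)
qed

text \<open>These are the test functions used near a degenerate touching point. Symmetry of
  \<open>A\<close> merges the two terms of the product rule into one gradient.\<close>

lemma C2_on_quadratic:
  fixes A :: "real^'n^'n"
  assumes "symmetric_mat A"
  shows "C2_on \<Omega> (\<lambda>x. (x - y) \<bullet> (A *v (x - y)) / 2) (\<lambda>x. A *v (x - y)) (\<lambda>x. A)"
proof -
  have D: "((\<lambda>x. A *v (x - y)) has_derivative (\<lambda>v. A *v v)) (at x)" for x
    by (rule bounded_linear.has_derivative[OF matrix_vector_mul_bounded_linear])
      (auto intro!: derivative_eq_intros)
  have "((\<lambda>x. (x - y) \<bullet> (A *v (x - y)) / 2) has_derivative (\<lambda>v. (A *v (x - y)) \<bullet> v)) (at x)" for x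
  proof -
    have "((\<lambda>x. (x - y) \<bullet> (A *v (x - y)) * (1 / 2)) has_derivative
        (\<lambda>v. ((x - y) \<bullet> (A *v v) + v \<bullet> (A *v (x - y))) * (1 / 2))) (at x)"
      by (intro has_derivative_mult_left has_derivative_inner D) (auto intro!: derivative_eq_intros)
    moreover have "((x - y) \<bullet> (A *v v) + v \<bullet> (A *v (x - y))) * (1 / 2) = (A *v (x - y)) \<bullet> v" for v
      unfolding symmetric_mat_inner[OF assms, of "x - y" v] inner_commute[of v] by simp
    ultimately show ?thesis
      by simp
  qed
  then show ?thesis
    using D by (simp add: C2_on_def)
qed

text \<open>Exchanging \<open>x\<close> and \<open>y\<close> bounds the absolute increment
  quadratically, so the derivative of \<open>u\<close> within \<open>S\<close> is zero
  everywhere.\<close>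

lemma quadratic_growth_imp_constant_on:
  fixes u :: "'a::real_normed_vector \<Rightarrow> real"
  assumes "convex S" and C: "\<And>x y. x \<in> S \<Longrightarrow> y \<in> S \<Longrightarrow> u y - u x \<le> C * (norm (x - y))\<^sup>2"
  shows "u constant_on S"
proof -
  have "(u has_derivative (\<lambda>h. 0)) (at x within S)" if x: "x \<in> S" for x
  proof (rule has_derivativeI_sandwich[where e=1 and H="\<lambda>y. C * norm (y - x)"])
    show "((\<lambda>y. C * norm (y - x)) \<longlongrightarrow> 0) (at x within S)"
      by (auto intro!: tendsto_eq_intros)
    show "norm (u y - u x - 0) / norm (y - x) \<le> C * norm (y - x)"
      if "y \<in> S" "y \<noteq> x" for y
    proof -
      have "\<bar>u y - u x\<bar> \<le> C * (norm (y - x))\<^sup>2"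
        using C[OF x that(1)] C[OF that(1) x] by (simp add: abs_le_iff norm_minus_commute)
      then show ?thesis
        using that by (simp add: divide_simps power2_eq_square mult.assoc)
    qed
  qed auto
  then show ?thesis
    using has_derivative_zero_constant[OF assms(1)] unfolding constant_on_def by blast
qed

section \<open>Uniformly elliptic operators\<close>

text \<open>The upper ellipticity bound makes \<open>F\<close> lose at most \<open>e * K\<close>
  under a shift by \<open>e\<close> times the identity, with \<open>K\<close> equal to
  \<open>Lam\<close> times the dimension.\<close>

lemma uniformly_elliptic_shift:
  assumes "uniformly_elliptic F" "symmetric_mat A" "c < F A"
  obtains d where "d > 0" "\<And>e. 0 < e \<Longrightarrow> e < d \<Longrightarrow> c < F (A - e *\<^sub>R mat 1)"
proof -
  obtain lam Lam where F: "0 < lam" "lam \<le> Lam"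
    "\<And>M N. symmetric_mat M \<Longrightarrow> psd_mat N \<Longrightarrow> F (M + N) - F M \<le> Lam * trace N"
    using assms(1) unfolding uniformly_elliptic_def by blast
  define K where "K = Lam * trace (mat 1 :: real^'a^'a)"
  have K: "K > 0"
    unfolding K_def using F by (simp add: trace_def mat_def)
  have step: "F A - F (A - e *\<^sub>R mat 1) \<le> e * K" if "e \<ge> 0" for e
  proof -
    have "trace (e *\<^sub>R mat 1 :: real^'a^'a) = e * trace (mat 1 :: real^'a^'a)"
      by (simp add: trace_def sum_distrib_left)
    then show ?thesis
      using F(3)[OF symmetric_mat_diff[OF assms(2) symmetric_mat_mat] psd_mat_mat[OF that], of e]
      by (simp add: K_def mult.left_commute)
  qed
  show ?thesis
  proof
    show "(F A - c) / K > 0"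
      using K assms(3) by simp
    show "c < F (A - e *\<^sub>R mat 1)" if "0 < e" "e < (F A - c) / K" for e
      using step[of e] that K by (simp add: pos_less_divide_eq)
  qed
qed

text \<open>The lower ellipticity bound is applied to the increment \<open>- A\<close> starting from
  \<open>A\<close>, which ends at 0.\<close>

lemma uniformly_elliptic_nonpos:
  assumes "uniformly_elliptic F" "F 0 = 0" "psd_mat (- A)"
  shows "F A \<le> 0"
proof -
  obtain lam where F: "0 < lam" 
    "\<And>M N. symmetric_mat M \<Longrightarrow> psd_mat N \<Longrightarrow> lam * trace N \<le> F (M + N) - F M"
    using assms(1) unfolding uniformly_elliptic_def by blast
  have "symmetric_mat A"
    using assms(3) symmetric_mat_uminus[of "- A"] by (simp add: psd_mat_def)
  then have "lam * trace (- A) \<le> F 0 - F A"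
    using F(2)[of A "- A"] assms(3) by simp
  then show ?thesis
    using F(1) trace_psd_nonneg[OF assms(3)] assms(2) mult_nonneg_nonneg[of lam "trace (- A)"] by linarith
qed

text \<open>The increment of the dual operator from \<open>M\<close> along \<open>N\<close> equals
  that of \<open>F\<close> from \<open>- (M + N)\<close> along \<open>N\<close>, so the same
  constants serve.\<close>

lemma uniformly_elliptic_dual:
  assumes "uniformly_elliptic F"
  shows "uniformly_elliptic (\<lambda>M. - F (- M))"
proof -
  obtain lam Lam where F: "0 < lam" "lam \<le> Lam"
    "\<And>M N. symmetric_mat M \<Longrightarrow> psd_mat N \<Longrightarrow>
        lam * trace N \<le> F (M + N) - F M \<and> F (M + N) - F M \<le> Lam * trace N"
    using assms unfolding uniformly_elliptic_def by blast
  have "lam * trace N \<le> - F (- (M + N)) - - F (- M) \<and> - F (- (M + N)) - - F (- M) \<le> Lam * trace N"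
    if M: "symmetric_mat M" and N: "psd_mat N" for M N
  proof -
    have "symmetric_mat (- (M + N))"
      using M N symmetric_mat_diff[OF symmetric_mat_uminus[OF M], of N] by (simp add: psd_mat_def)
    from F(3)[OF this N] show ?thesis
      by simp
  qed
  with F(1,2) show ?thesis
    unfolding uniformly_elliptic_def by blast
qed

section \<open>Touching with vanishing gradient\<close>

text \<open>If no such pair existed, every centre \<open>y\<close> near \<open>x0\<close> would
  minimise its own translated problem. Quadratic growth then makes \<open>u\<close> constant near
  \<open>x0\<close>, and touching a constant from below forces \<open>A\<close> to be negative
  semidefinite, against \<open>neg\<close>.\<close>

lemma strict_touching_nonconstant_gradient:
  fixes u :: "real^'n \<Rightarrow> real" and A :: "real^'n^'n"
  assumes r: "r > 0" and u: "continuous_on (cball x0 r) u"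
    and A: "symmetric_mat A" "\<And>v. A *v v = 0 \<Longrightarrow> v = 0"
    and touch: "\<And>w. norm w \<le> r \<Longrightarrow> u x0 + w \<bullet> (A *v w) / 2 + k * (norm w)\<^sup>2 \<le> u (x0 + w)"
    and k: "k > 0" and neg: "\<not> psd_mat (- A)"
  obtains x y where "x \<in> ball x0 r" "y \<in> ball x0 r" "A *v (x - y) \<noteq> 0"
    "\<And>z. z \<in> cball x0 r \<Longrightarrow>
        u x - (x - y) \<bullet> (A *v (x - y)) / 2 \<le> u z - (z - y) \<bullet> (A *v (z - y)) / 2"
proof (rule ccontr)
  note pick = that
  assume contr: "\<not> thesis"
  define g where "g y x = u x - (x - y) \<bullet> (A *v (x - y)) / 2" for x y
  obtain C where C: "C > 0" "\<And>w. norm (A *v w) \<le> norm w * C"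
    using bounded_linear.pos_bounded[OF matrix_vector_mul_bounded_linear[of A]] by blast
  have C2: "\<bar>v \<bullet> (A *v w)\<bar> \<le> C * norm v * norm w" for v w
    using Cauchy_Schwarz_ineq2[of v "A *v w"] mult_left_mono[OF C(2)[of w], of "norm v"]
    by (simp add: mult_ac)
  \<comment> \<open>On the sphere of radius \<open>r\<close>, moving the centre of the quadratic by
    less than \<open>s\<close> costs a cross term of at most \<open>C * r * s\<close>. The last
    bound in \<open>s\<close> keeps this below the strictness margin \<open>k * r\<^sup>2\<close>,
    so minimisers stay inside.\<close>
  define s where "s = min (min r 1) (k * r\<^sup>2 / (4 * C * (r + 1)))"
  have s: "s > 0" "s \<le> r" "s \<le> 1" "s \<le> k * r\<^sup>2 / (4 * C * (r + 1))"
    using r k C(1) by (auto simp: s_def)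
  have min_at: "g y y \<le> g y z" if y: "y \<in> ball x0 s" and z: "z \<in> cball x0 r" for y z
  proof -
    have "continuous_on (cball x0 r) (\<lambda>x. A *v (x - y))"
      by (intro bounded_linear.continuous_on[OF matrix_vector_mul_bounded_linear] continuous_intros)
    then have "continuous_on (cball x0 r) (g y)"
      unfolding g_def by (intro continuous_on_diff continuous_on_divide continuous_on_inner u
          continuous_on_id continuous_on_const) auto
    then obtain x where x: "x \<in> cball x0 r" "\<And>z. z \<in> cball x0 r \<Longrightarrow> g y x \<le> g y z"
      using continuous_attains_inf[of "cball x0 r" "g y"] r by auto
    have ny: "norm (y - x0) < s"
      using y by (simp add: dist_norm norm_minus_commute)
    have "norm (x - x0) < r"
    proof (rule ccontr)
      assume "\<not> norm (x - x0) < r"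
      then have nx: "norm (x - x0) = r"
        using x(1) by (simp add: dist_norm norm_minus_commute)
      define v w where "v = y - x0" and "w = x - x0"
      have nv: "norm v < s" and nw: "norm w = r"
        using ny nx by (simp_all add: v_def w_def)
      \<comment> \<open>The centre \<open>x0\<close> serves as competitor. The terms quadratic in
        \<open>v\<close> cancel, and the touching inequality removes those quadratic in
        \<open>w\<close>, leaving the margin against the cross term.\<close>
      have "g y x \<le> g y x0"
        using x(2) r by simp
      moreover have "g y x0 = u x0 - v \<bullet> (A *v v) / 2"
      proof -
        have "x0 - y = - v" by (simp add: v_def)
        then show ?thesis
          by (simp add: g_def linear_neg[OF matrix_vector_mul_linear])
      qed
      moreover have "(x - y) \<bullet> (A *v (x - y)) = w \<bullet> (A *v w) - 2 * (w \<bullet> (A *v v)) + v \<bullet> (A *v v)"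
      proof -
        have "x - y = w - v" by (simp add: v_def w_def)
        moreover have "v \<bullet> (A *v w) = w \<bullet> (A *v v)"
          using A(1) symmetric_mat_iff_inner by blast
        ultimately show ?thesis
          by (simp add: inner_diff_left inner_diff_right matrix_vector_mult_diff_distrib)
      qed
      moreover have "u x0 + w \<bullet> (A *v w) / 2 + k * r\<^sup>2 \<le> u x"
        using touch[of w] nw by (simp add: w_def)
      ultimately have "k * r\<^sup>2 \<le> - (w \<bullet> (A *v v))"
        unfolding g_def by linarith
      also have "\<dots> \<le> C * r * norm v"
        using C2[of w v] nw by simp
      also have "\<dots> \<le> C * r * s"
        using nv C(1) r by simp
      also have "\<dots> \<le> C * r * (k * r\<^sup>2 / (4 * C * (r + 1)))"
        using s(4) C(1) r by (intro mult_left_mono) auto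
      also have "\<dots> = (k * r\<^sup>2) * (r / (4 * (r + 1)))"
        using C(1) by simp
      also have "\<dots> < (k * r\<^sup>2) * 1"
        using k r by (intro mult_strict_left_mono) (auto simp: divide_simps)
      finally show False by simp
    qed
    then have "x \<in> ball x0 r"
      by (simp add: dist_norm norm_minus_commute)
    moreover have "y \<in> ball x0 r"
      using y s(2) by auto
    \<comment> \<open>A nonzero gradient here would provide the pair excluded by
      \<open>contr\<close>; nonsingularity of \<open>A\<close> then gives
      \<open>x = y\<close>.\<close>
    ultimately have "A *v (x - y) = 0"
      using pick[of x y] contr x(2) unfolding g_def by blast
    then have "x - y = 0"
      by (rule A(2))
    then have "x = y"
      by simp
    then show ?thesis
      using x(2) z by blast
  qed
  have "u constant_on ball x0 s"
  proof (rule quadratic_growth_imp_constant_on)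
    fix x y assume xy: "x \<in> ball x0 s" "y \<in> ball x0 s"
    have "u y \<le> u x - (x - y) \<bullet> (A *v (x - y)) / 2"
      using min_at[OF xy(2), of x] xy s(2) by (auto simp: g_def)
    also have "\<dots> \<le> u x + C / 2 * (norm (x - y))\<^sup>2"
      using C2[of "x - y" "x - y"] by (simp add: power2_eq_square mult.assoc)
    finally show "u y - u x \<le> C / 2 * (norm (x - y))\<^sup>2"
      by simp
  qed simp
  then have const: "u x = u x0" if "x \<in> ball x0 s" for x
    using that s(1) unfolding constant_on_def by (metis centre_in_ball)
  have "psd_mat (- A)"
    unfolding psd_mat_def
  proof (intro conjI allI)
    show "symmetric_mat (- A)"
      using A(1) by (rule symmetric_mat_uminus)
    fix v :: "real^'n"
    \<comment> \<open>Touching is known only near \<open>x0\<close>; homogeneity of the quadratic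
      form allows \<open>v\<close> to be scaled into that range.\<close>
    obtain t where t: "t > 0" "t * norm v < s"
      using small_scale[OF s(1), of "norm v"] by auto
    then have nt: "norm (t *\<^sub>R v) < s"
      by simp
    have "u x0 + (t *\<^sub>R v) \<bullet> (A *v (t *\<^sub>R v)) / 2 + k * (norm (t *\<^sub>R v))\<^sup>2 \<le> u (x0 + t *\<^sub>R v)"
      using nt s(2) by (intro touch) simp
    moreover have "u (x0 + t *\<^sub>R v) = u x0"
      using nt by (intro const) (simp add: dist_norm)
    moreover have "0 \<le> k * (norm (t *\<^sub>R v))\<^sup>2"
      using k by simp
    ultimately have "(t *\<^sub>R v) \<bullet> (A *v (t *\<^sub>R v)) \<le> 0"
      by linarith
    then have "t * (t * (v \<bullet> (A *v v))) \<le> 0"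
      by (simp add: matrix_vector_mult_scaleR)
    then have "v \<bullet> (A *v v) \<le> 0"
      using t by (simp add: mult_le_0_iff)
    then show "0 \<le> v \<bullet> (- A *v v)"
      by (simp add: matrix_vector_mult_minus_left)
  qed
  with neg show False by blast
qed

text \<open>The hypothesis \<open>small\<close> isolates all that is needed from the equation: near
  \<open>x0\<close>, test functions with small nonzero gradient have \<open>F\<close> of their
  Hessian below any prescribed positive level.\<close>

lemma degenerate_touching:
  fixes u :: "real^'n \<Rightarrow> real"
  assumes "open \<Omega>" "continuous_on \<Omega> u" "uniformly_elliptic F" "F 0 = 0" "x0 \<in> \<Omega>"
    and \<phi>: "C2_on \<Omega> \<phi> D D2" "local_min_at \<Omega> (\<lambda>x. u x - \<phi> x) x0" "D x0 = 0"
    and small: "\<And>c. c > 0 \<Longrightarrow> \<exists>\<eta>>0. \<forall>x\<in>ball x0 \<eta> \<inter> \<Omega>. \<forall>\<psi> E E2.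
        C2_on \<Omega> \<psi> E E2 \<longrightarrow> local_min_at \<Omega> (\<lambda>x. u x - \<psi> x) x \<longrightarrow> E x \<noteq> 0 \<longrightarrow> norm (E x) < \<eta>
          \<longrightarrow> F (E2 x) < c"
  shows "F (D2 x0) \<le> 0"
proof (rule ccontr)
  assume "\<not> F (D2 x0) \<le> 0"
  then have pos: "0 < F (D2 x0)" by simp
  have sym: "symmetric_mat (D2 x0)"
    using C2_on_hessian_symmetric assms(1,5) \<phi>(1) by blast
  obtain d where d: "d > 0" "\<And>e. 0 < e \<Longrightarrow> e < d \<Longrightarrow> 0 < F (D2 x0 - e *\<^sub>R mat 1)"
    using uniformly_elliptic_shift[OF assms(3) sym pos] by blast
  define S where "S = {e. \<exists>v. v \<noteq> 0 \<and> (D2 x0 - e *\<^sub>R mat 1) *v v = 0}"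
  have "infinite ({0<..<d} - S)"
    unfolding S_def using finite_singular_shifts[OF sym] d(1)
    by (intro Diff_infinite_finite) (auto simp: infinite_Ioo)
  then obtain e where "e \<in> {0<..<d} - S"
    using infinite_imp_nonempty by blast
  then have e: "0 < e" "e < d" "\<And>v. (D2 x0 - e *\<^sub>R mat 1) *v v = 0 \<Longrightarrow> v = 0"
    by (auto simp: S_def)
  define A where "A = D2 x0 - e *\<^sub>R mat 1"
  have A: "symmetric_mat A" "\<And>v. A *v v = 0 \<Longrightarrow> v = 0" "0 < F A"
    using e d(2) symmetric_mat_diff[OF sym symmetric_mat_mat] by (auto simp: A_def)
  have A_quad: "w \<bullet> (A *v w) = w \<bullet> (D2 x0 *v w) - e * (norm w)\<^sup>2" for w
    by (simp add: A_def matrix_vector_mult_diff_rdistrib mat_scaleR_vector_mult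
        inner_diff_right power2_norm_eq_inner)
  \<comment> \<open>Lowering the Hessian by \<open>e\<close> gains \<open>e / 2\<close> in the half
    quadratic form. A Taylor error of \<open>e / 4\<close> thus leaves the strictness margin
    \<open>e / 4\<close> in \<open>touch\<close>.\<close>
  obtain d1 where d1: "d1 > 0" "ball x0 d1 \<subseteq> \<Omega>"
    "\<And>w. norm w < d1 \<Longrightarrow> \<phi> x0 + w \<bullet> (D2 x0 *v w) / 2 - e / 4 * (norm w)\<^sup>2 \<le> \<phi> (x0 + w)"
    using C2_on_taylor_lower[OF assms(1) \<phi>(1) assms(5) \<phi>(3), of "e / 4"] e(1)
    by (metis zero_less_divide_iff zero_less_numeral)
  obtain d2 where d2: "d2 > 0"
    "\<And>x. x \<in> \<Omega> \<Longrightarrow> x \<noteq> x0 \<Longrightarrow> dist x x0 < d2 \<Longrightarrow> u x0 - \<phi> x0 \<le> u x - \<phi> x"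
    using \<phi>(2) unfolding local_min_at_def eventually_at by auto
  \<comment> \<open>The level is \<open>F A\<close> itself, so a quadratic with Hessian
    \<open>A\<close> that is admissible here gives the contradiction
    \<open>F A < F A\<close>.\<close>
  obtain \<eta> where \<eta>: "\<eta> > 0"
    "\<And>x \<psi> E E2. x \<in> ball x0 \<eta> \<Longrightarrow> x \<in> \<Omega> \<Longrightarrow> C2_on \<Omega> \<psi> E E2 \<Longrightarrow>
        local_min_at \<Omega> (\<lambda>x. u x - \<psi> x) x \<Longrightarrow> E x \<noteq> 0 \<Longrightarrow> norm (E x) < \<eta> \<Longrightarrow> F (E2 x) < F A"
    using small[OF A(3)] by blast
  obtain C where C: "C > 0" "\<And>w. norm (A *v w) \<le> norm w * C"
    using bounded_linear.pos_bounded[OF matrix_vector_mul_bounded_linear[of A]] by blast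
  \<comment> \<open>Points \<open>x\<close> and \<open>y\<close> of the ball of radius
    \<open>r\<close> are less than \<open>2 * r = m\<close> apart. The entry
    \<open>\<eta> / C\<close> then keeps the test gradient \<open>A *v (x - y)\<close> below
    \<open>\<eta>\<close> in norm.\<close>
  define m where "m = min (min d1 d2) (min \<eta> (\<eta> / C))"
  define r where "r = m / 2"
  have "m > 0" "m \<le> d1" "m \<le> d2" "m \<le> \<eta>" "m \<le> \<eta> / C"
    using d1(1) d2(1) \<eta>(1) C(1) by (simp_all add: m_def)
  then have r: "r > 0" "r < d1" "r < d2" "r < \<eta>" "2 * r \<le> \<eta> / C"
    unfolding r_def by linarith+
  have sub: "cball x0 r \<subseteq> \<Omega>"
    using d1(2) r(2) by (auto simp: subset_iff)
  have touch: "u x0 + w \<bullet> (A *v w) / 2 + e / 4 * (norm w)\<^sup>2 \<le> u (x0 + w)" if "norm w \<le> r" for w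
  proof -
    have "u x0 - \<phi> x0 \<le> u (x0 + w) - \<phi> (x0 + w)"
    proof (cases "w = 0")
      case False
      then show ?thesis
        using d2(2)[of "x0 + w"] sub that r(3) by (auto simp: subset_iff dist_norm)
    qed simp
    then show ?thesis
      using d1(3)[of w] that r(2) A_quad[of w] by (simp add: field_simps)
  qed
  have "\<not> psd_mat (- A)"
    using uniformly_elliptic_nonpos[OF assms(3,4)] A(3) by fastforce
  then obtain x y where xy: "x \<in> ball x0 r" "y \<in> ball x0 r" "A *v (x - y) \<noteq> 0"
    "\<And>z. z \<in> cball x0 r \<Longrightarrow>
        u x - (x - y) \<bullet> (A *v (x - y)) / 2 \<le> u z - (z - y) \<bullet> (A *v (z - y)) / 2"
    using strict_touching_nonconstant_gradient[OF r(1) continuous_on_subset[OF assms(2) sub]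
        A(1,2) touch, of thesis] e(1) by auto
  have "norm (x - y) < 2 * r"
    using dist_triangle_half_l[of x x0 "2 * r" y] xy(1,2)
    by (simp add: dist_norm norm_minus_commute)
  then have "norm (x - y) * C < 2 * r * C"
    using C(1) by simp
  also have "\<dots> \<le> \<eta>"
    using r(5) C(1) by (simp add: pos_le_divide_eq)
  finally have "norm (A *v (x - y)) < \<eta>"
    using C(2)[of "x - y"] by linarith
  moreover have "local_min_at \<Omega> (\<lambda>x. u x - (x - y) \<bullet> (A *v (x - y)) / 2) x"
  proof -
    have "\<forall>\<^sub>F z in at x within \<Omega>. z \<in> ball x0 r"
      using xy(1) by (intro eventually_at_in_open' eventually_at_topological[THEN iffD2])
        (auto intro!: exI[of _ "ball x0 r"])
    then show ?thesis
      unfolding local_min_at_def by eventually_elim (use xy(4) in auto)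
  qed
  moreover have "x \<in> ball x0 \<eta>" "x \<in> \<Omega>"
    using xy(1) r(4) sub by auto
  ultimately have "F A < F A"
    using \<eta>(2)[OF _ _ C2_on_quadratic[OF A(1), of \<Omega> y], of x] xy(3) by blast
  then show False by simp
qed

section \<open>Duality between sub- and supersolutions\<close>

lemma C2_on_uminus:
  assumes "C2_on \<Omega> \<phi> D D2"
  shows "C2_on \<Omega> (\<lambda>x. - \<phi> x) (\<lambda>x. - D x) (\<lambda>x. - D2 x)"
  unfolding C2_on_def
proof (intro conjI ballI)
  fix x assume x: "x \<in> \<Omega>"
  have "(\<phi> has_derivative (\<lambda>v. D x \<bullet> v)) (at x)" "(D has_derivative (\<lambda>v. D2 x *v v)) (at x)"
    using assms x by (auto simp: C2_on_def)
  from this[THEN has_derivative_minus]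
  show "((\<lambda>x. - \<phi> x) has_derivative (\<lambda>v. - D x \<bullet> v)) (at x)"
    "((\<lambda>x. - D x) has_derivative (\<lambda>v. - D2 x *v v)) (at x)"
    by (simp_all add: matrix_vector_mult_minus_left)
qed (use assms in \<open>auto simp: C2_on_def intro: continuous_on_minus\<close>)

lemma local_min_at_uminus:
  "local_min_at \<Omega> (\<lambda>x. - u x - - \<phi> x) x0 \<longleftrightarrow> local_max_at \<Omega> (\<lambda>x. u x - \<phi> x) x0"
  by (simp add: local_min_at_def local_max_at_def algebra_simps)

text \<open>Testing with \<open>- \<phi>\<close> swaps touching from above and from below. The dual
  of \<open>singular_lhs\<close> is again of that form, so the supersolution argument can be
  reused.\<close>

lemma bd_subsolution_dual:
  assumes "bd_subsolution \<Omega> G f u"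
  shows "bd_supersolution \<Omega> (\<lambda>x p X. - G x (- p) (- X)) (\<lambda>x. - f x) (\<lambda>x. - u x)"
  unfolding bd_supersolution_def
proof (intro conjI ballI)
  show "continuous_on \<Omega> (\<lambda>x. - u x)"
    using assms by (auto simp: bd_subsolution_def intro: continuous_on_minus)
  fix x0 assume "x0 \<in> \<Omega>"
  then consider
      r where "r > 0" "ball x0 r \<subseteq> \<Omega>" "u constant_on ball x0 r" "\<forall>x\<in>ball x0 r. 0 \<ge> f x"
    | (test) "\<And>\<phi> D D2. C2_on \<Omega> \<phi> D D2 \<Longrightarrow> local_max_at \<Omega> (\<lambda>x. u x - \<phi> x) x0 \<Longrightarrow> D x0 \<noteq> 0
        \<Longrightarrow> G x0 (D x0) (D2 x0) \<ge> f x0"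
    using assms unfolding bd_subsolution_def by blast
  then show "(\<exists>r>0. ball x0 r \<subseteq> \<Omega> \<and> (\<lambda>x. - u x) constant_on ball x0 r \<and> (\<forall>x\<in>ball x0 r. 0 \<le> - f x)) \<or>
      (\<forall>\<phi> D D2. C2_on \<Omega> \<phi> D D2 \<and> local_min_at \<Omega> (\<lambda>x. - u x - \<phi> x) x0 \<and> D x0 \<noteq> 0
        \<longrightarrow> - G x0 (- D x0) (- D2 x0) \<le> - f x0)"
  proof cases
    case 1
    have "(\<lambda>x. - u x) constant_on ball x0 r"
      using 1(3) by (auto simp: constant_on_def)
    then show ?thesis
      using 1 by auto
  next
    case test
    have "- G x0 (- D x0) (- D2 x0) \<le> - f x0"
      if "C2_on \<Omega> \<phi> D D2" "local_min_at \<Omega> (\<lambda>x. - u x - \<phi> x) x0" "D x0 \<noteq> 0" for \<phi> D D2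
      using test[OF C2_on_uminus[OF that(1)]] local_min_at_uminus[of \<Omega> u "\<lambda>x. - \<phi> x" x0] that(2,3)
      by simp
    then show ?thesis
      by blast
  qed
qed

text \<open>The return direction of the duality, carrying the result for \<open>- u\<close> back to
  \<open>u\<close>.\<close>

lemma visc_subsolution_dual:
  assumes "visc_supersolution \<Omega> (\<lambda>x p X. - G x (- p) (- X)) (\<lambda>x p. - R x (- p)) (\<lambda>x. - u x)"
  shows "visc_subsolution \<Omega> G R u"
  unfolding visc_subsolution_def
proof (intro conjI ballI allI impI)
  show "continuous_on \<Omega> u"
    using assms continuous_on_minus[of \<Omega> "\<lambda>x. - u x"] by (simp add: visc_supersolution_def)
  fix x0 \<phi> D D2
  assume "x0 \<in> \<Omega>" and \<phi>: "C2_on \<Omega> \<phi> D D2 \<and> local_max_at \<Omega> (\<lambda>x. u x - \<phi> x) x0"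
  then have \<phi>': "C2_on \<Omega> (\<lambda>x. - \<phi> x) (\<lambda>x. - D x) (\<lambda>x. - D2 x)"
      "local_min_at \<Omega> (\<lambda>x. - u x - - \<phi> x) x0"
    using C2_on_uminus local_min_at_uminus by blast+
  have "- G x0 (- E x0) (- E2 x0) \<le> - R x0 (- E x0)"
    if "C2_on \<Omega> \<psi> E E2" "local_min_at \<Omega> (\<lambda>x. - u x - \<psi> x) x0" for \<psi> E E2
    using assms \<open>x0 \<in> \<Omega>\<close> that unfolding visc_supersolution_def by simp
  from this[OF \<phi>'] show "R x0 (D x0) \<le> G x0 (D x0) (D2 x0)"
    by simp
qed

section \<open>From the singular to the regular equation\<close>

text \<open>Where \<open>u\<close> is constant, touching from below makes \<open>x0\<close> a local
  maximum of \<open>\<phi>\<close>.\<close>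

lemma constant_touching_gradient:
  fixes x0 :: "real^'n"
  assumes "open \<Omega>" "x0 \<in> \<Omega>" "C2_on \<Omega> \<phi> D D2" "local_min_at \<Omega> (\<lambda>x. u x - \<phi> x) x0"
    and "r > 0" "u constant_on ball x0 r"
  shows "D x0 = 0"
proof -
  have "\<forall>\<^sub>F x in at x0. x \<in> ball x0 r"
    using assms(5) by (intro eventually_at_in_open') auto
  moreover have "\<forall>\<^sub>F x in at x0. u x0 - \<phi> x0 \<le> u x - \<phi> x"
    using assms(4) unfolding local_min_at_def at_within_open[OF assms(2,1)] .
  ultimately have "\<forall>\<^sub>F x in at x0. \<phi> x \<le> \<phi> x0"
  proof eventually_elim
    case (elim x)
    moreover have "x0 \<in> ball x0 r"
      using assms(5) by simp
    ultimately show ?case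
      using assms(6) unfolding constant_on_def by force
  qed
  then obtain d where d: "d > 0" "\<And>x. x \<noteq> x0 \<Longrightarrow> dist x x0 < d \<Longrightarrow> \<phi> x \<le> \<phi> x0"
    unfolding eventually_at by auto
  have "\<forall>x\<in>ball x0 d. \<phi> x \<le> \<phi> x0"
    using d(2) by (metis dist_commute mem_ball order_refl)
  moreover have "(\<phi> has_derivative (\<lambda>v. D x0 \<bullet> v)) (at x0)"
    using assms(2,3) by (simp add: C2_on_def)
  ultimately have "(\<lambda>v. D x0 \<bullet> v) = (\<lambda>v. 0)"
    using d(1) by (intro differential_zero_maxmin[of x0 "ball x0 d" \<phi>]) auto
  then show ?thesis
    by (metis inner_eq_zero_iff)
qed

text \<open>The locally constant alternative cannot occur together with a nonzero test gradient, so
  the inequality holds for all such tests.\<close>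

lemma bd_supersolution_test:
  fixes x0 :: "real^'n"
  assumes "open \<Omega>" "bd_supersolution \<Omega> G f u" "x0 \<in> \<Omega>"
    and "C2_on \<Omega> \<phi> D D2" "local_min_at \<Omega> (\<lambda>x. u x - \<phi> x) x0" "D x0 \<noteq> 0"
  shows "G x0 (D x0) (D2 x0) \<le> f x0"
  using assms constant_touching_gradient[OF assms(1,3,4,5)]
  unfolding bd_supersolution_def by blast

lemma singular_lhs_le_iff:
  assumes "p \<noteq> 0"
  shows "singular_lhs \<alpha> F h b x p X \<le> c \<longleftrightarrow> regular_lhs \<alpha> F h b x p X \<le> c * norm p powr (- \<alpha>)"
proof -
  define m where "m = norm p powr (- \<alpha>)"
  have m: "m > 0" "norm p powr \<alpha> = 1 / m"
    using assms by (simp_all add: m_def powr_minus divide_simps)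
  have "singular_lhs \<alpha> F h b x p X \<le> c \<longleftrightarrow> m * singular_lhs \<alpha> F h b x p X \<le> m * c"
    using m(1) by simp
  also have "m * singular_lhs \<alpha> F h b x p X = regular_lhs \<alpha> F h b x p X"
    using m by (simp add: singular_lhs_def regular_lhs_def distrib_left flip: m_def)
  finally show ?thesis
    by (simp add: m_def mult.commute)
qed

text \<open>Near \<open>x0\<close> the functions \<open>f\<close> and \<open>h\<close> are bounded,
  and \<open>b\<close> is bounded for gradients of norm at most 1. Since
  \<open>- \<alpha> > 0\<close>, everything besides \<open>F\<close> in the rescaled equation tends
  to 0 with the gradient.\<close>

lemma lower_order_terms_vanish:
  fixes x0 :: "real^'n" and b :: "real^'n \<Rightarrow> real^'n \<Rightarrow> real"
  assumes "open \<Omega>" "x0 \<in> \<Omega>" "continuous_on \<Omega> f" "continuous_on \<Omega> h" "\<alpha> < 0" "c > 0"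
    and b: "\<And>x p. norm p \<le> 1 \<Longrightarrow> \<bar>b x p\<bar> \<le> K"
  obtains \<eta> where "\<eta> > 0"
    "\<And>x p. x \<in> ball x0 \<eta> \<Longrightarrow> norm p < \<eta> \<Longrightarrow>
        (f x - b x p) * norm p powr (- \<alpha>) - h x \<bullet> p < c"
proof -
  have "isCont f x0" "isCont h x0"
    using assms(1-4) by (simp_all add: continuous_on_eq_continuous_at)
  then have *: "\<exists>d>0. \<forall>x. dist x x0 < d \<longrightarrow> dist (f x) (f x0) < 1"
    "\<exists>d>0. \<forall>x. dist x x0 < d \<longrightarrow> dist (h x) (h x0) < 1"
    unfolding continuous_at_eps_delta by simp_all
  obtain d1 where d1: "d1 > 0" "\<And>x. dist x x0 < d1 \<Longrightarrow> dist (f x) (f x0) < 1"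
    using *(1) by blast
  obtain d2 where d2: "d2 > 0" "\<And>x. dist x x0 < d2 \<Longrightarrow> dist (h x) (h x0) < 1"
    using *(2) by blast
  define d where "d = min d1 d2"
  have d: "d > 0" "\<And>x. x \<in> ball x0 d \<Longrightarrow> dist (f x) (f x0) < 1 \<and> dist (h x) (h x0) < 1"
    using d1 d2 by (auto simp: d_def dist_commute)
  define M where "M = \<bar>f x0\<bar> + 1 + K"
  define H where "H = norm (h x0) + 1"
  have "((\<lambda>t. M * t powr (- \<alpha>) + H * t) \<longlongrightarrow> M * 0 powr (- \<alpha>) + H * 0) (at_right 0)"
    using assms(5) by (intro tendsto_intros tendsto_powr')
      (auto intro: eventually_mono[OF eventually_at_right_less])
  then have "\<forall>\<^sub>F t in at_right 0. M * t powr (- \<alpha>) + H * t < c"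
    using assms(5,6) by (intro order_tendstoD(2)) auto
  then obtain e where e: "e > 0" "\<And>t. 0 < t \<Longrightarrow> t < e \<Longrightarrow> M * t powr (- \<alpha>) + H * t < c"
    unfolding eventually_at_right_field by auto
  show ?thesis
  proof
    \<comment> \<open>The entry 1 keeps \<open>norm p\<close> in the range where the bound
      \<open>K\<close> holds.\<close>
    show "min d (min e 1) > 0"
      using d(1) e(1) by simp
    fix x p :: "real^'n"
    assume x: "x \<in> ball x0 (min d (min e 1))" and p: "norm p < min d (min e 1)"
    have "\<bar>f x\<bar> \<le> \<bar>f x0\<bar> + 1" "norm (h x) \<le> H"
      using d(2)[of x] x norm_triangle_ineq2[of "h x" "h x0"] by (auto simp: dist_norm H_def)
    moreover have "\<bar>b x p\<bar> \<le> K"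
      using b p by simp
    ultimately have "f x - b x p \<le> M"
      by (simp add: M_def)
    then have "(f x - b x p) * norm p powr (- \<alpha>) \<le> M * norm p powr (- \<alpha>)"
      by (rule mult_right_mono) simp
    moreover have "- (h x \<bullet> p) \<le> H * norm p"
      using Cauchy_Schwarz_ineq2[of "h x" p] mult_right_mono[OF \<open>norm (h x) \<le> H\<close>, of "norm p"] by simp
    \<comment> \<open>The limit at 0 concerns positive norms only; at \<open>p = 0\<close> both
      terms vanish because \<open>0 powr (- \<alpha>) = 0\<close>.\<close>
    moreover have "M * norm p powr (- \<alpha>) + H * norm p < c"
      using e(2)[of "norm p"] p assms(6) by (cases "p = 0") auto
    ultimately show "(f x - b x p) * norm p powr (- \<alpha>) - h x \<bullet> p < c"
      by linarith
  qed
qed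

text \<open>Nonzero test gradients are handled by multiplying with a positive power of their norm; a
  zero gradient reduces to \<open>degenerate_touching\<close>.\<close>

lemma singular_imp_regular_supersolution:
  fixes u :: "real^'n \<Rightarrow> real"
  assumes "open \<Omega>" "\<alpha> < 0" "uniformly_elliptic F" "F 0 = 0"
    and "continuous_on \<Omega> h" "continuous_on \<Omega> f"
    and b: "\<And>x p. norm p \<le> 1 \<Longrightarrow> \<bar>b x p\<bar> \<le> K"
    and u: "bd_supersolution \<Omega> (singular_lhs \<alpha> F h b) f u"
  shows "visc_supersolution \<Omega> (regular_lhs \<alpha> F h b) (\<lambda>x p. f x * norm p powr (- \<alpha>)) u"
  unfolding visc_supersolution_def
proof (intro conjI ballI allI impI)
  show u_cont: "continuous_on \<Omega> u"
    using u by (simp add: bd_supersolution_def)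
  have test: "regular_lhs \<alpha> F h b x (E x) (E2 x) \<le> f x * norm (E x) powr (- \<alpha>)"
    if "x \<in> \<Omega>" "C2_on \<Omega> \<psi> E E2" "local_min_at \<Omega> (\<lambda>x. u x - \<psi> x) x" "E x \<noteq> 0" for x \<psi> E E2
    using bd_supersolution_test[OF assms(1) u that] singular_lhs_le_iff that(4) by blast
  fix x0 \<phi> D D2
  assume x0: "x0 \<in> \<Omega>" and "C2_on \<Omega> \<phi> D D2 \<and> local_min_at \<Omega> (\<lambda>x. u x - \<phi> x) x0"
  then have \<phi>: "C2_on \<Omega> \<phi> D D2" "local_min_at \<Omega> (\<lambda>x. u x - \<phi> x) x0"
    by simp_all
  show "regular_lhs \<alpha> F h b x0 (D x0) (D2 x0) \<le> f x0 * norm (D x0) powr (- \<alpha>)"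
  proof (cases "D x0 = 0")
    case False
    then show ?thesis
      using test x0 \<phi> by blast
  next
    case True
    have "F (D2 x0) \<le> 0"
    proof (rule degenerate_touching[OF assms(1) u_cont assms(3,4) x0 \<phi> True])
      fix c :: real assume "c > 0"
      obtain \<eta> where \<eta>: "\<eta> > 0"
        "\<And>x p. x \<in> ball x0 \<eta> \<Longrightarrow> norm p < \<eta> \<Longrightarrow>
            (f x - b x p) * norm p powr (- \<alpha>) - h x \<bullet> p < c"
        using lower_order_terms_vanish[OF assms(1) x0 assms(6,5,2) \<open>c > 0\<close>, of b K] b by blast
      have "F (E2 x) < c"
        if "x \<in> ball x0 \<eta> \<inter> \<Omega>" "C2_on \<Omega> \<psi> E E2" "local_min_at \<Omega> (\<lambda>x. u x - \<psi> x) x"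
          "E x \<noteq> 0" "norm (E x) < \<eta>" for x \<psi> E E2
        using test[OF _ that(2-4)] \<eta>(2)[of x "E x"] that(1,5)
        by (simp add: regular_lhs_def algebra_simps)
      then show "\<exists>\<eta>>0. \<forall>x\<in>ball x0 \<eta> \<inter> \<Omega>. \<forall>\<psi> E E2.
          C2_on \<Omega> \<psi> E E2 \<longrightarrow> local_min_at \<Omega> (\<lambda>x. u x - \<psi> x) x \<longrightarrow> E x \<noteq> 0 \<longrightarrow> norm (E x) < \<eta>
            \<longrightarrow> F (E2 x) < c"
        using \<eta>(1) by blast
    qed
    \<comment> \<open>At zero gradient the transport term and both terms with the factor
      \<open>0 powr (- \<alpha>)\<close> vanish, leaving only \<open>F (D2 x0)\<close>.\<close>
    then show ?thesis
      by (simp add: True regular_lhs_def)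
  qed
qed

text \<open>The supremum part of the norm bounds \<open>b\<close> pointwise, and positive exponents
  keep both powers at most 1 when \<open>norm p \<le> 1\<close>.\<close>

lemma cond_b1_bounded:
  assumes "cond_b1 \<alpha> \<beta>o \<beta>inf b"
  obtains K where "\<And>x p. norm p \<le> 1 \<Longrightarrow> \<bar>b x p\<bar> \<le> K"
proof -
  obtain \<gamma> M where M: "M > 0"
    "\<And>q. hoelder_norm \<gamma> (\<lambda>x. b x q) \<le> ennreal (M * (norm q powr \<beta>o + norm q powr \<beta>inf))"
    and \<beta>: "\<beta>o > 0" "\<beta>inf > 0"
    using assms unfolding cond_b1_def by auto
  have "\<bar>b x p\<bar> \<le> M * 2" if p: "norm p \<le> 1" for x p
  proof -
    have "norm p powr \<beta>o \<le> 1" "norm p powr \<beta>inf \<le> 1"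
      using p \<beta> by (auto intro!: powr_le1)
    then have *: "M * (norm p powr \<beta>o + norm p powr \<beta>inf) \<le> M * 2"
      using M(1) by (intro mult_left_mono) auto
    have "ennreal \<bar>b x p\<bar> \<le> (SUP x. ennreal \<bar>b x p\<bar>)"
      by (rule SUP_upper) simp
    also have "\<dots> \<le> hoelder_norm \<gamma> (\<lambda>x. b x p)"
      unfolding hoelder_norm_def by (rule le_iff_add[THEN iffD2]) blast
    also note M(2)[of p]
    finally have "\<bar>b x p\<bar> \<le> M * (norm p powr \<beta>o + norm p powr \<beta>inf)"
      using M(1) by (simp add: ennreal_le_iff)
    with * show ?thesis
      by linarith
  qed
  then show ?thesis
    by (rule that)
qed

text \<open>The normalisation \<open>F 0 = 0\<close> matches the convention that the singular
  left-hand side is 0 on constants: for \<open>f = 0\<close> constants solve the singular equation,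
  while testing the regular one with a constant function on a nonempty \<open>\<Omega>\<close>
  requires \<open>F 0 = 0\<close>.\<close>

theorem proposition1p2:
  fixes F :: "real^'n^'n \<Rightarrow> real"
    and h :: "real^'n \<Rightarrow> real^'n"
    and f u :: "real^'n \<Rightarrow> real"
    and b :: "real^'n \<Rightarrow> real^'n \<Rightarrow> real"
    and \<Omega> :: "(real^'n) set"
    and \<alpha> \<beta>o \<beta>inf :: real
  assumes "open \<Omega>"
    and "\<alpha> \<in> {-1<..<0}"
    and "uniformly_elliptic F"
    and "F 0 = 0"
    and "\<exists>L. L-lipschitz_on \<Omega> h"
    and "continuous_on \<Omega> f"
    and "cond_b1 \<alpha> \<beta>o \<beta>inf b"
    and "cond_b2 \<beta>o \<beta>inf b"
    and "bd_solution \<Omega> (singular_lhs \<alpha> F h b) f u"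
  shows "visc_solution \<Omega> (regular_lhs \<alpha> F h b) (\<lambda>x p. f x * norm p powr (-\<alpha>)) u"
proof -
  obtain K where K: "\<And>x p. norm p \<le> 1 \<Longrightarrow> \<bar>b x p\<bar> \<le> K"
    using cond_b1_bounded[OF assms(7)] by blast
  have h: "continuous_on \<Omega> h" and \<alpha>: "\<alpha> < 0"
    using assms(2,5) lipschitz_on_continuous_on by auto
  let ?F = "\<lambda>M. - F (- M)" and ?b = "\<lambda>x p. - b x (- p)"
  have super: "bd_supersolution \<Omega> (singular_lhs \<alpha> F h b) f u"
    and sub: "bd_subsolution \<Omega> (singular_lhs \<alpha> F h b) f u"
    using assms(9) by (simp_all add: bd_solution_def)
  \<comment> \<open>The field \<open>h\<close> is unchanged under duality, since the two signs in
    the transport term cancel.\<close>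
  have "(\<lambda>x p X. - singular_lhs \<alpha> F h b x (- p) (- X)) = singular_lhs \<alpha> ?F h ?b"
    by (simp add: fun_eq_iff singular_lhs_def algebra_simps)
  then have "bd_supersolution \<Omega> (singular_lhs \<alpha> ?F h ?b) (\<lambda>x. - f x) (\<lambda>x. - u x)"
    using bd_subsolution_dual[OF sub] by simp
  then have "visc_supersolution \<Omega> (regular_lhs \<alpha> ?F h ?b)
      (\<lambda>x p. - f x * norm p powr (- \<alpha>)) (\<lambda>x. - u x)"
    using assms(4) K by (intro singular_imp_regular_supersolution[where K=K] assms(1) \<alpha> h
        uniformly_elliptic_dual assms(3) continuous_on_minus assms(6)) auto
  moreover have "regular_lhs \<alpha> ?F h ?b = (\<lambda>x p X. - regular_lhs \<alpha> F h b x (- p) (- X))"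
    by (simp add: fun_eq_iff regular_lhs_def algebra_simps)
  ultimately have "visc_subsolution \<Omega> (regular_lhs \<alpha> F h b) (\<lambda>x p. f x * norm p powr (-\<alpha>)) u"
    by (intro visc_subsolution_dual) simp
  then show ?thesis
    using singular_imp_regular_supersolution[OF assms(1) \<alpha> assms(3,4) h assms(6) K super]
    by (simp add: visc_solution_def)
qed

end
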